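(* Let $L$ be a finite dimensional simple Lie algebra over $\mathbb{C}$. Then a map $f:L\times L\to L$ is a biderivation of $L$ if and only if there is a complex number $\lambda$ such that $f(x,y)=\lambda[x,y]$ for all $x,y\in L$.
   Context: A biderivation of a Lie algebra $L$ is a bilinear map $f:L\times L\to L$ such that $f([x,y],z)=[x,f(y,z)]+[f(x,z),y]$ and $f(x,[y,z])=[f(x,y),z]+[y,f(x,z)]$ for all $x,y,z\in L$. No skewsymmetry of $f$ is assumed. *)

theory Defs
  imports Complex_Main
begin

definition bilinear_map :: "(complex \<Rightarrow> 'a::ab_group_add \<Rightarrow> 'a) \<Rightarrow> ('a \<Rightarrow> 'a \<Rightarrow> 'a) \<Rightarrow> bool" where
  "bilinear_map sc f \<longleftrightarrow>
     (\<forall>x. Vector_Spaces.linear sc sc (\<lambda>y. f x y)) \<and>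
     (\<forall>y. Vector_Spaces.linear sc sc (\<lambda>x. f x y))"

definition lie_algebra :: "(complex \<Rightarrow> 'a::ab_group_add \<Rightarrow> 'a) \<Rightarrow> ('a \<Rightarrow> 'a \<Rightarrow> 'a) \<Rightarrow> bool" where
  "lie_algebra sc br \<longleftrightarrow>
     vector_space sc \<and> bilinear_map sc br \<and>
     (\<forall>x. br x x = 0) \<and>
     (\<forall>x y z. br x (br y z) + br y (br z x) + br z (br x y) = 0)"

definition finite_dim_lie_algebra :: "(complex \<Rightarrow> 'a::ab_group_add \<Rightarrow> 'a) \<Rightarrow> ('a \<Rightarrow> 'a \<Rightarrow> 'a) \<Rightarrow> bool" where
  "finite_dim_lie_algebra sc br \<longleftrightarrow>
     lie_algebra sc br \<and> (\<exists>B. finite B \<and> module.span sc B = UNIV)"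

definition lie_ideal :: "(complex \<Rightarrow> 'a::ab_group_add \<Rightarrow> 'a) \<Rightarrow> ('a \<Rightarrow> 'a \<Rightarrow> 'a) \<Rightarrow> 'a set \<Rightarrow> bool" where
  "lie_ideal sc br I \<longleftrightarrow> module.subspace sc I \<and> (\<forall>x y. y \<in> I \<longrightarrow> br x y \<in> I)"

definition simple_lie_algebra :: "(complex \<Rightarrow> 'a::ab_group_add \<Rightarrow> 'a) \<Rightarrow> ('a \<Rightarrow> 'a \<Rightarrow> 'a) \<Rightarrow> bool" where
  "simple_lie_algebra sc br \<longleftrightarrow>
     lie_algebra sc br \<and> (\<exists>x y. br x y \<noteq> 0) \<and>
     (\<forall>I. lie_ideal sc br I \<longrightarrow> I = {0} \<or> I = UNIV)"

definition biderivation :: "(complex \<Rightarrow> 'a::ab_group_add \<Rightarrow> 'a) \<Rightarrow> ('a \<Rightarrow> 'a \<Rightarrow> 'a) \<Rightarrow> ('a \<Rightarrow> 'a \<Rightarrow> 'a) \<Rightarrow> bool" where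
  "biderivation sc br f \<longleftrightarrow>
     bilinear_map sc f \<and>
     (\<forall>x y z. f (br x y) z = br x (f y z) + br (f x z) y) \<and>
     (\<forall>x y z. f x (br y z) = br (f x y) z + br y (f x z))"

end

theory Submission
  imports Defs
    "HOL-Computational_Algebra.Fundamental_Theorem_Algebra"
    "HOL-Computational_Algebra.Polynomial_Factorial"
    "HOL-Computational_Algebra.Field_as_Ring"
begin

text \<open>Expanding \<open>f [x, u] [y, v]\<close> in two ways shows that a skew-symmetric biderivation satisfies
  \<open>[f x y, [u, v]] = [[x, y], f u v]\<close>. On a perfect centreless algebra this makes it \<open>\<gamma> [x, y]\<close> for
  some \<open>\<gamma>\<close> in the centroid, and \<open>\<gamma>\<close> is a scalar by Schur's lemma. A symmetric biderivation vanishes,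
  because the Killing form pairs its values to zero with everything. Only the Killing form of a simple
  algebra being nonzero is needed for this: otherwise, pairing \<open>ad x\<close> with the derivation that acts
  on the generalised eigenspaces of \<open>ad x\<close> by the conjugate eigenvalues shows that every \<open>ad x\<close> is
  nilpotent, which Engel's theorem forbids.\<close>

section \<open>Polynomials in an endomorphism of a finite-dimensional complex space\<close>

locale complex_fin_dim = finite_dimensional_vector_space sc Basis
  for sc :: "complex \<Rightarrow> 'a::ab_group_add \<Rightarrow> 'a" and Basis :: "'a set"
begin

abbreviation endo :: "('a \<Rightarrow> 'a) \<Rightarrow> bool" where
  "endo T \<equiv> Vector_Spaces.linear sc sc T"

lemma endoI:
  assumes "\<And>x y. T (x + y) = T x + T y" "\<And>c x. T (sc c x) = sc c (T x)"
  shows "endo T"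
  by (simp add: Vector_Spaces.linear_iff vector_space_axioms assms)

lemma
  assumes "endo T"
  shows endo_add: "T (x + y) = T x + T y"
    and endo_scale: "T (sc c x) = sc c (T x)"
    and endo_0: "T 0 = 0"
    and endo_diff: "T (x - y) = T x - T y"
    and endo_sum: "T (sum h A) = (\<Sum>i\<in>A. T (h i))"
proof -
  interpret T: module_hom sc sc T
    using assms by (rule Vector_Spaces.linear.axioms)
  show "T (x + y) = T x + T y" "T (sc c x) = sc c (T x)" "T 0 = 0" "T (x - y) = T x - T y"
    "T (sum h A) = (\<Sum>i\<in>A. T (h i))"
    by (simp_all add: T.add T.scale T.zero T.diff T.sum)
qed

text \<open>This is the operator p(T) applied to \<open>v\<close>, evaluated by Horner's rule; it
  turns the space into a module over the polynomial ring.\<close>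

definition poly_act :: "('a \<Rightarrow> 'a) \<Rightarrow> complex poly \<Rightarrow> 'a \<Rightarrow> 'a" where
  "poly_act T p v = fold_coeffs (\<lambda>a w. sc a v + T w) p 0"

lemma poly_act_0 [simp]: "poly_act T 0 v = 0"
  by (simp add: poly_act_def)

lemma poly_act_pCons:
  assumes "endo T"
  shows "poly_act T (pCons a p) v = sc a v + T (poly_act T p v)"
  by (cases "a = 0 \<and> p = 0") (auto simp: poly_act_def endo_0[OF assms] fold_coeffs_pCons_not_0_0_eq)

lemma poly_act_add:
  assumes "endo T"
  shows "poly_act T (p + q) v = poly_act T p v + poly_act T q v"
proof (induction p q rule: poly_induct2)
  case (pCons a p b q)
  then show ?case
    by (simp add: poly_act_pCons[OF assms] endo_add[OF assms] scale_left_distrib algebra_simps)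
qed auto

lemma poly_act_smult:
  assumes "endo T"
  shows "poly_act T (smult c p) v = sc c (poly_act T p v)"
  by (induction p)
    (simp_all add: poly_act_pCons[OF assms] endo_scale[OF assms] scale_right_distrib)

lemma poly_act_mult:
  assumes "endo T"
  shows "poly_act T (p * q) v = poly_act T p (poly_act T q v)"
  by (induction p)
    (simp_all add: poly_act_pCons[OF assms] poly_act_add[OF assms] poly_act_smult[OF assms])

lemma poly_act_linear:
  assumes "endo T"
  shows "endo (poly_act T p)"
proof (rule endoI)
  show "poly_act T p (x + y) = poly_act T p x + poly_act T p y" for x y
    by (induction p)
      (simp_all add: poly_act_pCons[OF assms] endo_add[OF assms] scale_right_distrib algebra_simps)
  show "poly_act T p (sc c x) = sc c (poly_act T p x)" for c x
    by (induction p)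
      (simp_all add: poly_act_pCons[OF assms] endo_scale[OF assms] scale_right_distrib mult.commute)
qed

lemma poly_act_diff:
  assumes "endo T"
  shows "poly_act T (p - q) v = poly_act T p v - poly_act T q v"
  using poly_act_add[OF assms, of "p - q" q v] by (simp add: algebra_simps)

lemma poly_act_1:
  assumes "endo T"
  shows "poly_act T 1 v = v"
  by (simp add: one_pCons poly_act_pCons[OF assms] endo_0[OF assms])

lemma poly_act_linear_factor:
  assumes "endo T"
  shows "poly_act T [:-\<mu>, 1:] v = T v - sc \<mu> v"
  by (simp add: poly_act_pCons[OF assms] endo_0[OF assms])

lemma poly_act_eigenvector:
  assumes "endo T" "T v = sc \<mu> v"
  shows "poly_act T p v = sc (poly p \<mu>) v"
  by (induction p)
    (simp_all add: poly_act_pCons[OF assms(1)] endo_scale[OF assms(1)] assms(2)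
      scale_left_distrib mult.commute)

text \<open>If no nonzero polynomial in \<open>T\<close> killed \<open>v\<close>, the iterates T^n v
  would be independent, and \<open>Suc dimension\<close> of them are too many.\<close>

lemma poly_act_annihilator:
  assumes "endo T"
  shows "\<exists>p. p \<noteq> 0 \<and> poly_act T p v = 0"
proof (rule ccontr)
  assume *: "\<nexists>p. p \<noteq> 0 \<and> poly_act T p v = 0"
  define e where "e i = poly_act T (monom 1 i) v" for i
  \<comment> \<open>The degree bound is put on coefficients so that \<open>V 0\<close> is the zero
    space; with \<open>degree p < n\<close> it would be empty and not a subspace.\<close>
  define V where "V n = {poly_act T p v | p. \<forall>i\<ge>n. coeff p i = 0}" for n
  have V: "subspace (V n)" for n
  proof (rule subspaceI)
    show "0 \<in> V n"
      unfolding V_def by (auto intro!: exI[of _ 0])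
    show "x + y \<in> V n" if "x \<in> V n" "y \<in> V n" for x y
      using that unfolding V_def by (force simp: poly_act_add[OF assms, symmetric])
    show "sc c x \<in> V n" if "x \<in> V n" for c x
      using that unfolding V_def by (force simp: poly_act_smult[OF assms, symmetric])
  qed
  have "e ` {..<n} \<subseteq> V n" for n
    by (auto simp: V_def e_def)
  then have span: "span (e ` {..<n}) \<subseteq> V n" for n
    by (rule span_minimal[OF _ V])
  have notin: "e n \<notin> span (e ` {..<n})" for n
  proof
    assume "e n \<in> span (e ` {..<n})"
    then obtain p where p: "e n = poly_act T p v" "\<forall>i\<ge>n. coeff p i = 0"
      using span[of n] by (auto simp: V_def)
    then have "poly_act T (monom 1 n - p) v = 0"
      by (simp add: poly_act_diff[OF assms] e_def)
    then have "monom 1 n - p = 0"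
      using * by blast
    then have "p = monom 1 n"
      by simp
    then have "coeff p n = 1"
      by simp
    with p(2) show False
      by simp
  qed
  have "dim (e ` {..<n}) = n" for n
  proof (induction n)
    case (Suc n)
    have "e ` {..<Suc n} = insert (e n) (e ` {..<n})"
      by (simp add: lessThan_Suc)
    with Suc notin[of n] show ?case
      by (simp only: dim_insert) simp
  qed simp
  with dim_subset_UNIV[of "e ` {..<Suc dimension}"] show False
    by simp
qed

section \<open>Generalised eigenspaces: spanning, independence, eigenvectors\<close>

definition gen_eigenspace :: "('a \<Rightarrow> 'a) \<Rightarrow> complex \<Rightarrow> 'a set" where
  "gen_eigenspace T \<mu> = {v. \<exists>k. poly_act T ([:-\<mu>, 1:] ^ k) v = 0}"

lemma subspace_gen_eigenspace:
  assumes "endo T"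
  shows "subspace (gen_eigenspace T \<mu>)"
proof (rule subspaceI)
  note lin = poly_act_linear[OF assms]
  show "0 \<in> gen_eigenspace T \<mu>"
    by (simp add: gen_eigenspace_def endo_0[OF lin])
  show "sc c x \<in> gen_eigenspace T \<mu>" if "x \<in> gen_eigenspace T \<mu>" for c x
    using that by (auto simp: gen_eigenspace_def endo_scale[OF lin])
  show "x + y \<in> gen_eigenspace T \<mu>" if xy: "x \<in> gen_eigenspace T \<mu>" "y \<in> gen_eigenspace T \<mu>" for x y
  proof -
    obtain k l where k: "poly_act T ([:-\<mu>, 1:] ^ k) x = 0" and l: "poly_act T ([:-\<mu>, 1:] ^ l) y = 0"
      using xy by (auto simp: gen_eigenspace_def)
    have "poly_act T ([:-\<mu>, 1:] ^ (k + l)) x = poly_act T ([:-\<mu>, 1:] ^ l * [:-\<mu>, 1:] ^ k) x"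
      "poly_act T ([:-\<mu>, 1:] ^ (k + l)) y = poly_act T ([:-\<mu>, 1:] ^ k * [:-\<mu>, 1:] ^ l) y"
      by (simp_all add: power_add mult.commute)
    with k l have "poly_act T ([:-\<mu>, 1:] ^ (k + l)) (x + y) = 0"
      by (simp only: poly_act_mult[OF assms] endo_add[OF lin] endo_0[OF lin]) simp
    then show ?thesis
      by (auto simp: gen_eigenspace_def)
  qed
qed

lemma gen_eigenspaceI:
  assumes "endo T" "T v - sc \<mu> v \<in> gen_eigenspace T \<mu>"
  shows "v \<in> gen_eigenspace T \<mu>"
proof -
  obtain k where "poly_act T ([:-\<mu>, 1:] ^ k) (T v - sc \<mu> v) = 0"
    using assms(2) by (auto simp: gen_eigenspace_def)
  then have "poly_act T ([:-\<mu>, 1:] ^ Suc k) v = 0"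
    by (simp only: power_Suc2 poly_act_mult[OF assms(1)] poly_act_linear_factor[OF assms(1)])
  then show ?thesis
    unfolding gen_eigenspace_def by blast
qed

text \<open>Along the orbit of a generalised eigenvector outside \<open>U\<close>, the last vector outside \<open>U\<close> is an
  eigenvector modulo \<open>U\<close>.\<close>
lemma eigenvector_modulo:
  assumes T: "endo T" and "v \<in> gen_eigenspace T \<mu>" "v \<notin> U" "0 \<in> U" "v \<in> W"
    and W: "subspace W" "\<And>w. w \<in> W \<Longrightarrow> T w \<in> W"
  shows "\<exists>w. w \<in> gen_eigenspace T \<mu> \<and> w \<in> W \<and> w \<notin> U \<and> T w - sc \<mu> w \<in> U"
proof -
  obtain k where k: "poly_act T ([:-\<mu>, 1:] ^ k) v = 0"
    using assms(2) by (auto simp: gen_eigenspace_def)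
  then show ?thesis
    using assms(3,5)
  proof (induction k arbitrary: v)
    case 0
    then show ?case using \<open>0 \<in> U\<close> by (simp add: poly_act_1[OF T])
  next
    case (Suc k)
    have k: "poly_act T ([:-\<mu>, 1:] ^ k) (T v - sc \<mu> v) = 0"
      using Suc.prems(1)
      by (simp only: power_Suc2 poly_act_mult[OF T] poly_act_linear_factor[OF T])
    have "v \<in> gen_eigenspace T \<mu>"
      using Suc.prems(1) unfolding gen_eigenspace_def by blast
    moreover have "T v - sc \<mu> v \<in> W"
      using W Suc.prems(3) by (simp add: subspace_diff subspace_scale)
    ultimately show ?case
      using Suc.IH[OF k] Suc.prems by blast
  qed
qed

text \<open>Every vector has a nonzero annihilating polynomial. Induction on its degree peels off
  one root at a time: Bezout splits the vector into a generalised eigenvector and a vector killed by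
  a polynomial of smaller degree.\<close>

lemma span_gen_eigenspaces:
  assumes T: "endo T"
  shows "span (\<Union>\<mu>. gen_eigenspace T \<mu>) = UNIV"
proof -
  let ?U = "span (\<Union>\<mu>. gen_eigenspace T \<mu>)"
  have "v \<in> ?U" if "p \<noteq> 0" "poly_act T p v = 0" for p v
    using that
  proof (induction "degree p" arbitrary: p v rule: less_induct)
    case less
    show ?case
    proof (cases "degree p = 0")
      case True
      then obtain c where "p = [:c:]"
        by (rule degree_eq_zeroE)
      with less.prems have "c \<noteq> 0" "sc c v = 0"
        by (auto simp: poly_act_pCons[OF T] endo_0[OF T])
      then show ?thesis
        by (simp add: span_zero)
    next
      case False
      then obtain \<mu> where \<mu>: "poly p \<mu> = 0"
        using alg_closed_imp_poly_has_root[of p] by auto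
      let ?X = "[:-\<mu>, 1:]"
      have "order \<mu> p \<noteq> 0"
        using \<mu> less.prems(1) by (simp add: order_root)
      \<comment> \<open>Dividing out the full multiplicity of the root is what makes
        \<open>q\<close> coprime to \<open>?X\<close>.\<close>
      then obtain n q where q: "p = ?X ^ n * q" "\<not> ?X dvd q" and n: "n \<noteq> 0"
        using order_decomp[OF less.prems(1)] by metis
      have q0: "q \<noteq> 0"
        using q(2) by auto
      have "degree p = n + degree q"
        by (simp add: q(1) degree_mult_eq q0 degree_power_eq)
      then have deg: "degree q < degree p"
        using n by simp
      have "prime_elem ?X"
        by (rule prime_elem_linear_field_poly) simp
      then have "coprime ?X q"
        using q(2) by (rule prime_elem_imp_coprime)
      then have "coprime (?X ^ n) q"
        by simp
      then obtain a b where ab: "a * ?X ^ n + b * q = 1"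
        by (metis bezout_coefficients_fst_snd coprime_iff_gcd_eq_1)
      \<comment> \<open>Since \<open>p\<close> kills \<open>v\<close>, the cofactor \<open>q\<close>
        kills \<open>y\<close>, so the induction hypothesis applies to \<open>y\<close>, while
        \<open>?X ^ n\<close> kills \<open>z\<close>.\<close>
      define y z where "y = poly_act T (a * ?X ^ n) v" and "z = poly_act T (b * q) v"
      have v: "v = y + z"
        unfolding y_def z_def poly_act_add[OF T, symmetric] ab by (simp add: poly_act_1[OF T])
      have "poly_act T q y = poly_act T (q * (a * ?X ^ n)) v"
        by (simp only: y_def poly_act_mult[OF T])
      also have "q * (a * ?X ^ n) = a * p"
        by (simp add: q(1) mult_ac)
      also have "poly_act T (a * p) v = 0"
        by (simp add: poly_act_mult[OF T] less.prems(2) endo_0[OF poly_act_linear[OF T]])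
      finally have y: "y \<in> ?U"
        using less.hyps[OF deg q0] by blast
      have "poly_act T (?X ^ n) z = poly_act T (?X ^ n * (b * q)) v"
        by (simp only: z_def poly_act_mult[OF T])
      also have "?X ^ n * (b * q) = b * p"
        by (simp add: q(1) mult_ac)
      also have "poly_act T (b * p) v = 0"
        by (simp add: poly_act_mult[OF T] less.prems(2) endo_0[OF poly_act_linear[OF T]])
      finally have "z \<in> ?U"
        by (intro span_base) (auto simp: gen_eigenspace_def)
      with y show ?thesis
        unfolding v by (rule span_add)
    qed
  qed
  with poly_act_annihilator[OF T] show ?thesis
    by blast
qed

text \<open>The vectors killed by some polynomial not vanishing at \<mu> form a
  \<open>T\<close>-invariant subspace \<open>W\<close> containing all the other generalised
  eigenspaces. A nonzero \<open>v\<close> in both would produce an eigenvector for \<mu> inside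
  \<open>W\<close>, on which such a polynomial acts by a nonzero scalar.\<close>

lemma gen_eigenspaces_direct:
  assumes T: "endo T"
    and v: "v \<in> gen_eigenspace T \<mu>" "v \<in> span (\<Union>\<nu>\<in>-{\<mu>}. gen_eigenspace T \<nu>)"
  shows "v = 0"
proof (rule ccontr)
  assume "v \<noteq> 0"
  define W where "W = {w. \<exists>q. poly q \<mu> \<noteq> 0 \<and> poly_act T q w = 0}"
  note lin = poly_act_linear[OF T]
  have W: "subspace W"
  proof (rule subspaceI)
    show "0 \<in> W"
      unfolding W_def by (auto intro!: exI[of _ 1] simp: poly_act_1[OF T])
    show "sc c x \<in> W" if "x \<in> W" for c x
      using that by (auto simp: W_def endo_scale[OF lin])
    show "x + y \<in> W" if xy: "x \<in> W" "y \<in> W" for x y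
    proof -
      obtain p q where pq: "poly p \<mu> \<noteq> 0" "poly_act T p x = 0" "poly q \<mu> \<noteq> 0" "poly_act T q y = 0"
        using xy by (auto simp: W_def)
      have "poly_act T (p * q) (x + y) = poly_act T (q * p) x + poly_act T (p * q) y"
        by (simp add: endo_add[OF lin] mult.commute)
      also have "\<dots> = 0"
        using pq by (simp add: poly_act_mult[OF T] endo_0[OF lin])
      finally show ?thesis
        unfolding W_def using pq by (auto intro!: exI[of _ "p * q"])
    qed
  qed
  have "(\<Union>\<nu>\<in>-{\<mu>}. gen_eigenspace T \<nu>) \<subseteq> W"
  proof (rule UN_least, rule subsetI)
    fix \<nu> w assume "\<nu> \<in> -{\<mu>}" "w \<in> gen_eigenspace T \<nu>"
    then obtain k where "poly_act T ([:-\<nu>, 1:] ^ k) w = 0"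
      by (auto simp: gen_eigenspace_def)
    with \<open>\<nu> \<in> -{\<mu>}\<close> show "w \<in> W"
      unfolding W_def by (auto intro!: exI[of _ "[:-\<nu>, 1:] ^ k"])
  qed
  then have "v \<in> W"
    using v(2) span_minimal[OF _ W] by blast
  moreover have "T w \<in> W" if w: "w \<in> W" for w
  proof -
    obtain q where q: "poly q \<mu> \<noteq> 0" "poly_act T q w = 0"
      using w by (auto simp: W_def)
    have "poly_act T q (T w) = poly_act T (q * [:0, 1:]) w"
      by (simp only: poly_act_mult[OF T]) (simp add: poly_act_pCons[OF T] endo_0[OF T])
    also have "\<dots> = poly_act T ([:0, 1:] * q) w"
      by (simp only: mult.commute)
    also have "\<dots> = 0"
      using q by (simp only: poly_act_mult[OF T] endo_0[OF lin])
    finally show ?thesis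
      using q by (auto simp: W_def)
  qed
  ultimately obtain w where w: "w \<in> W" "w \<noteq> 0" "T w - sc \<mu> w = 0"
    using eigenvector_modulo[OF T v(1), of "{0}" W] W \<open>v \<noteq> 0\<close> by auto
  obtain q where "poly q \<mu> \<noteq> 0" "poly_act T q w = 0"
    using w(1) by (auto simp: W_def)
  with w poly_act_eigenvector[OF T, of w \<mu> q] show False
    by simp
qed

lemma exists_eigenvector:
  assumes T: "endo T" and "\<exists>x::'a. x \<noteq> 0"
  shows "\<exists>\<mu> v. v \<noteq> 0 \<and> T v = sc \<mu> v"
proof -
  have "\<not> (\<Union>\<mu>. gen_eigenspace T \<mu>) \<subseteq> {0}"
  proof
    assume "(\<Union>\<mu>. gen_eigenspace T \<mu>) \<subseteq> {0}"
    then have "span (\<Union>\<mu>. gen_eigenspace T \<mu>) \<subseteq> {0}"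
      by (rule span_minimal) simp
    with span_gen_eigenspaces[OF T] assms(2) show False
      by auto
  qed
  then obtain \<mu> v where "v \<in> gen_eigenspace T \<mu>" "v \<notin> {0}"
    by blast
  then show ?thesis
    using eigenvector_modulo[OF T, of v \<mu> "{0}" UNIV] by auto
qed

text \<open>The upper triangular form of \<open>T\<close>, recording only what is needed to compute traces.\<close>
lemma adapted_basis:
  assumes T: "endo T"
  shows "\<exists>B m. independent B \<and> span B = UNIV \<and>
    (\<forall>b\<in>B. b \<in> gen_eigenspace T (m b) \<and> representation B (T b) b = m b)"
proof -
  \<comment> \<open>A largest partial basis with invariant span is extended by an eigenvector modulo
    that span, until it spans everything.\<close>
  define Q where "Q B \<longleftrightarrow> independent B \<and> (\<forall>b\<in>B. T b \<in> span B) \<and>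
    (\<exists>m. \<forall>b\<in>B. b \<in> gen_eigenspace T (m b) \<and> representation B (T b) b = m b)" for B
  have bound: "card B < Suc dimension" if "Q B" for B
    using that independent_card_le_dim[of B UNIV] by (simp add: Q_def dimension_def)
  have "Q {}"
    by (simp add: Q_def independent_empty)
  then obtain B where B: "Q B" and max: "\<And>C. Q C \<Longrightarrow> card C \<le> card B"
    using ex_has_greatest_nat[of Q "{}" card "Suc dimension"] bound by auto
  have indep: "independent B" and inv: "\<And>b. b \<in> B \<Longrightarrow> T b \<in> span B"
    using B by (auto simp: Q_def)
  obtain m where m: "\<And>b. b \<in> B \<Longrightarrow> b \<in> gen_eigenspace T (m b)"
    "\<And>b. b \<in> B \<Longrightarrow> representation B (T b) b = m b"
    using B by (auto simp: Q_def)
  have "span B = UNIV"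
  proof (rule ccontr)
    assume "span B \<noteq> UNIV"
    then have "\<not> (\<Union>\<mu>. gen_eigenspace T \<mu>) \<subseteq> span B"
      using span_minimal[OF _ subspace_span, of "\<Union>\<mu>. gen_eigenspace T \<mu>" B]
        span_gen_eigenspaces[OF T] by auto
    then obtain \<mu> v where "v \<in> gen_eigenspace T \<mu>" "v \<notin> span B"
      by blast
    then obtain w where w: "w \<in> gen_eigenspace T \<mu>" "w \<notin> span B" "T w - sc \<mu> w \<in> span B"
      using eigenvector_modulo[OF T, of v \<mu> "span B" UNIV] span_zero by auto
    let ?C = "insert w B"
    have wB: "w \<notin> B"
      using w(2) span_base by blast
    have C: "independent ?C"
      using indep w(2) by (simp add: independent_insert)
    have sub: "span B \<subseteq> span ?C"
      by (rule span_mono) auto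
    have wC: "w \<in> span ?C"
      by (simp add: span_base)
    have Tw: "T w = sc \<mu> w + (T w - sc \<mu> w)"
      by simp
    have TwC: "T w \<in> span ?C"
      by (subst Tw) (use w(3) sub wC in \<open>blast intro: span_add span_scale\<close>)
    have rest: "representation ?C u = representation B u" if "u \<in> span B" for u
      using representation_extend[OF C that] by blast
    have rest_w: "representation B u w = 0" for u
      using representation_ne_zero[of B u w] wB by blast
    \<comment> \<open>Vectors of \<open>span B\<close> have coordinate 0 at \<open>w\<close>, so
      only the summand \<open>sc \<mu> w\<close> contributes to the new diagonal entry.\<close>
    have "representation ?C (T w) w = \<mu>"
    proof (subst Tw, subst representation_add[OF C])
      show "representation ?C (sc \<mu> w) w + representation ?C (T w - sc \<mu> w) w = \<mu>"
        by (simp add: rest[OF w(3)] rest_w representation_scale[OF C wC] representation_basis[OF C])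
    qed (use w(3) sub wC in \<open>auto intro: span_scale\<close>)
    then have "\<forall>b\<in>?C. b \<in> gen_eigenspace T ((m(w := \<mu>)) b) \<and> representation ?C (T b) b = (m(w := \<mu>)) b"
      using w(1) m wB by (auto simp: rest inv)
    moreover have "\<forall>b\<in>?C. T b \<in> span ?C"
      using TwC inv sub by auto
    ultimately have "Q ?C"
      using C unfolding Q_def by blast
    then have "card ?C \<le> card B"
      by (rule max)
    with wB finiteI_independent[OF indep] show False
      by simp
  qed
  with indep m show ?thesis
    by blast
qed

section \<open>Traces relative to a fixed basis\<close>

definition trace_in :: "'a set \<Rightarrow> ('a \<Rightarrow> 'a) \<Rightarrow> complex" where
  "trace_in B A = (\<Sum>b\<in>B. representation B (A b) b)"

context
  fixes B assumes indep: "independent B" and span: "span B = UNIV"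
begin

lemma representation_simps:
  "representation B (x + y) b = representation B x b + representation B y b"
  "representation B (x - y) b = representation B x b - representation B y b"
  "representation B (sc c x) b = c * representation B x b"
  "representation B (sum h A) b = (\<Sum>i\<in>A. representation B (h i) b)"
  by (simp_all add: representation_add representation_diff representation_scale representation_sum
      indep span)

lemma trace_in_simps:
  "trace_in B (\<lambda>x. A x + C x) = trace_in B A + trace_in B C"
  "trace_in B (\<lambda>x. A x - C x) = trace_in B A - trace_in B C"
  "trace_in B (\<lambda>x. sc c (A x)) = c * trace_in B A"
  by (simp_all add: trace_in_def representation_simps sum.distrib sum_subtractf sum_distrib_left)

text \<open>Both sides expand to the same double sum of products of matrix entries, with the order
  of summation exchanged.\<close>

lemma trace_in_commute:
  assumes A: "endo A" and C: "endo C"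
  shows "trace_in B (\<lambda>x. A (C x)) = trace_in B (\<lambda>x. C (A x))"
proof -
  have *: "trace_in B (\<lambda>x. F (G x)) =
      (\<Sum>b\<in>B. \<Sum>c\<in>B. representation B (G b) c * representation B (F c) b)" if F: "endo F" for F G
  proof -
    have "representation B (F (G b)) b = (\<Sum>c\<in>B. representation B (G b) c * representation B (F c) b)" for b
    proof -
      have G: "(\<Sum>c\<in>B. sc (representation B (G b) c) c) = G b"
        by (rule sum_representation_eq) (simp_all add: indep span finiteI_independent)
      have "F (\<Sum>c\<in>B. sc (representation B (G b) c) c) = (\<Sum>c\<in>B. sc (representation B (G b) c) (F c))"
        by (simp add: endo_sum[OF F] endo_scale[OF F])
      then have "F (G b) = (\<Sum>c\<in>B. sc (representation B (G b) c) (F c))"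
        unfolding G .
      then show ?thesis
        by (simp add: representation_simps)
    qed
    then show ?thesis
      by (simp add: trace_in_def)
  qed
  show ?thesis
    unfolding *[OF A] *[OF C] by (subst sum.swap) (simp add: mult.commute)
qed

end

end

section \<open>Lie brackets and derivations\<close>

locale fin_dim_lie_algebra = complex_fin_dim +
  fixes br :: "'a \<Rightarrow> 'a \<Rightarrow> 'a"
  assumes bilinear_br: "bilinear_map sc br"
    and br_self [simp]: "br x x = 0"
    and jacobi: "br x (br y z) + br y (br z x) + br z (br x y) = 0"
begin

lemma bilinear_endo:
  assumes "bilinear_map sc h"
  shows "endo (\<lambda>y. h x y)" "endo (\<lambda>x. h x y)"
  using assms by (simp_all add: bilinear_map_def)

lemmas bilinear_simps =
  endo_add[OF bilinear_endo(1)] endo_add[OF bilinear_endo(2)]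
  endo_diff[OF bilinear_endo(1)] endo_diff[OF bilinear_endo(2)]
  endo_scale[OF bilinear_endo(1)] endo_scale[OF bilinear_endo(2)]
  endo_0[OF bilinear_endo(1)] endo_0[OF bilinear_endo(2)]

lemmas br_simps = bilinear_simps[OF bilinear_br]

lemma endo_ad: "endo (br x)"
  using bilinear_endo(1)[OF bilinear_br] .

lemma br_antisym: "br x y = - br y x"
proof -
  have "br x y + br y x = br (x + y) (x + y)"
    unfolding br_simps by (simp add: add.commute)
  then show ?thesis
    by (simp add: eq_neg_iff_add_eq_0)
qed

lemma br_minus: "br x (- y) = - br x y" "br (- x) y = - br x y"
  using endo_diff[OF bilinear_endo(1)[OF bilinear_br], of x 0 y]
    endo_diff[OF bilinear_endo(2)[OF bilinear_br], of 0 x y]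
  by (simp_all add: br_simps)

definition derivation :: "('a \<Rightarrow> 'a) \<Rightarrow> bool" where
  "derivation D \<longleftrightarrow> endo D \<and> (\<forall>x y. D (br x y) = br (D x) y + br x (D y))"

lemma ad_br: "br x (br y z) = br (br x y) z + br y (br x z)"
proof -
  have "br y (br z x) = - br y (br x z)" "br z (br x y) = - br (br x y) z"
    using br_antisym[of z x] br_antisym[of z "br x y"] by (simp_all add: br_minus)
  with jacobi[of x y z] have "br x (br y z) + - br y (br x z) + - br (br x y) z = 0"
    by simp
  then show ?thesis
    by (simp add: algebra_simps)
qed

lemma br_br: "br (br x y) z = br x (br y z) - br y (br x z)"
  unfolding ad_br[of x y z] by simp

lemma derivation_ad: "derivation (br x)"
  unfolding derivation_def using endo_ad ad_br by blast

text \<open>By Leibniz, D - (\<alpha> + \<beta>) sends [y, z] to [(D - \<alpha>) y, z] +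
  [y, (D - \<beta>) z]. Each summand lowers one of the two nilpotency exponents, so induction on
  their sum applies.\<close>

lemma br_gen_eigenspace:
  assumes D: "derivation D"
    and "y \<in> gen_eigenspace D \<alpha>" "z \<in> gen_eigenspace D \<beta>"
  shows "br y z \<in> gen_eigenspace D (\<alpha> + \<beta>)"
proof -
  have T: "endo D" and Leibniz: "\<And>x y. D (br x y) = br (D x) y + br x (D y)"
    using D by (simp_all add: derivation_def)
  have "br y z \<in> gen_eigenspace D (\<alpha> + \<beta>)"
    if "poly_act D ([:-\<alpha>, 1:] ^ k) y = 0" "poly_act D ([:-\<beta>, 1:] ^ l) z = 0" for k l
    using that
  proof (induction "k + l" arbitrary: k l y z)
    case 0
    then show ?case
      using subspace_0[OF subspace_gen_eigenspace[OF T]]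
      by (simp add: poly_act_1[OF T] br_simps)
  next
    case (Suc n)
    show ?case
    proof (cases "k = 0 \<or> l = 0")
      case True
      then show ?thesis
        using Suc.prems subspace_0[OF subspace_gen_eigenspace[OF T]]
        by (auto simp: poly_act_1[OF T] br_simps)
    next
      case False
      then obtain k' l' where kl: "k = Suc k'" "l = Suc l'"
        by (meson not0_implies_Suc)
      have y: "poly_act D ([:-\<alpha>, 1:] ^ k') (D y - sc \<alpha> y) = 0"
        using Suc.prems(1) unfolding kl
        by (simp only: power_Suc2 poly_act_mult[OF T] poly_act_linear_factor[OF T])
      have z: "poly_act D ([:-\<beta>, 1:] ^ l') (D z - sc \<beta> z) = 0"
        using Suc.prems(2) unfolding kl
        by (simp only: power_Suc2 poly_act_mult[OF T] poly_act_linear_factor[OF T])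
      have "br (D y - sc \<alpha> y) z \<in> gen_eigenspace D (\<alpha> + \<beta>)"
        using Suc.hyps(1)[OF _ y Suc.prems(2)] Suc.hyps(2) kl by simp
      moreover have "br y (D z - sc \<beta> z) \<in> gen_eigenspace D (\<alpha> + \<beta>)"
        using Suc.hyps(1)[OF _ Suc.prems(1) z] Suc.hyps(2) kl by simp
      moreover have "D (br y z) - sc (\<alpha> + \<beta>) (br y z) = br (D y - sc \<alpha> y) z + br y (D z - sc \<beta> z)"
        by (simp add: Leibniz br_simps scale_left_distrib algebra_simps)
      ultimately have "D (br y z) - sc (\<alpha> + \<beta>) (br y z) \<in> gen_eigenspace D (\<alpha> + \<beta>)"
        by (simp only: subspace_add[OF subspace_gen_eigenspace[OF T]])
      then show ?thesis
        by (rule gen_eigenspaceI[OF T])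
    qed
  qed
  with assms(2,3) show ?thesis
    by (auto simp: gen_eigenspace_def)
qed

text \<open>Complex conjugation is additive, so rescaling the generalised eigenspaces of \<open>D\<close> by the
  conjugate eigenvalues is again a derivation.\<close>
lemma conjugate_derivation:
  assumes D: "derivation D" and B: "independent B" "span B = UNIV"
    and m: "\<And>b. b \<in> B \<Longrightarrow> b \<in> gen_eigenspace D (m b)"
  shows "\<exists>\<delta>. derivation \<delta> \<and> (\<forall>b\<in>B. \<delta> b = sc (cnj (m b)) b)"
proof -
  have T: "endo D"
    using D by (simp add: derivation_def)
  interpret vp: vector_space_pair sc sc
    by unfold_locales
  obtain \<delta> where \<delta>: "endo \<delta>" and \<delta>B: "\<And>b. b \<in> B \<Longrightarrow> \<delta> b = sc (cnj (m b)) b"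
    using vp.linear_independent_extend[OF B(1), of "\<lambda>b. sc (cnj (m b)) b"] by blast
  \<comment> \<open>The map is prescribed on \<open>B\<close> only. The part of \<open>v\<close>
    along basis vectors with other eigenvalues vanishes by directness, so it acts as a scalar on the
    whole generalised eigenspace.\<close>
  have \<delta>_gen: "\<delta> v = sc (cnj \<mu>) v" if v: "v \<in> gen_eigenspace D \<mu>" for v \<mu>
  proof -
    let ?B1 = "{b\<in>B. m b = \<mu>}" and ?B2 = "{b\<in>B. m b \<noteq> \<mu>}"
    have "v \<in> span (?B1 \<union> ?B2)"
      using B(2) by (simp add: Un_def conj_disj_distribL[symmetric])
    then obtain x y where xy: "v = x + y" "x \<in> span ?B1" "y \<in> span ?B2"
      unfolding span_Un by blast
    have "span ?B1 \<subseteq> gen_eigenspace D \<mu>"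
      using m by (intro span_minimal subspace_gen_eigenspace[OF T]) auto
    then have "v - x \<in> gen_eigenspace D \<mu>"
      using v xy(2) by (blast intro: subspace_diff[OF subspace_gen_eigenspace[OF T]])
    moreover have "y \<in> span (\<Union>\<nu>\<in>-{\<mu>}. gen_eigenspace D \<nu>)"
      using xy(3) m by (rule_tac set_mp[OF span_mono]) auto
    ultimately have "y = 0"
      using gen_eigenspaces_direct[OF T] xy(1) by simp
    have "span ?B1 \<subseteq> {x. \<delta> x = sc (cnj \<mu>) x}"
      by (rule span_minimal)
        (auto intro!: subspaceI simp: \<delta>B endo_add[OF \<delta>] endo_scale[OF \<delta>] endo_0[OF \<delta>]
          scale_right_distrib mult.commute)
    with xy \<open>y = 0\<close> show ?thesis
      by auto
  qed
  have \<delta>_BB: "\<delta> (br b c) = br (\<delta> b) c + br b (\<delta> c)" if "b \<in> B" "c \<in> B" for b c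
    using \<delta>_gen[OF br_gen_eigenspace[OF D m[OF that(1)] m[OF that(2)]]]
    by (simp add: that \<delta>B br_simps scale_left_distrib)
  \<comment> \<open>The Leibniz rule passes from pairs of basis vectors to all pairs, one argument
    at a time.\<close>
  have "span B \<subseteq> {x. \<forall>c\<in>B. \<delta> (br x c) = br (\<delta> x) c + br x (\<delta> c)}"
    by (rule span_minimal)
      (auto intro!: subspaceI simp: \<delta>_BB endo_add[OF \<delta>] endo_scale[OF \<delta>] endo_0[OF \<delta>]
        br_simps scale_right_distrib)
  then have \<delta>_B: "\<delta> (br x c) = br (\<delta> x) c + br x (\<delta> c)" if "c \<in> B" for x c
    using B(2) that by auto
  have "span B \<subseteq> {y. \<forall>x. \<delta> (br x y) = br (\<delta> x) y + br x (\<delta> y)}"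
    by (rule span_minimal)
      (auto intro!: subspaceI simp: \<delta>_B endo_add[OF \<delta>] endo_scale[OF \<delta>] endo_0[OF \<delta>]
        br_simps scale_right_distrib)
  then have "derivation \<delta>"
    using B(2) \<delta> by (auto simp: derivation_def)
  with \<delta>B show ?thesis
    by blast
qed

section \<open>The Killing form, Cartan's criterion and Engel's theorem\<close>

definition killing :: "'a set \<Rightarrow> 'a \<Rightarrow> 'a \<Rightarrow> complex" where
  "killing B x y = trace_in B (\<lambda>z. br x (br y z))"

lemma endo_comp: "endo S \<Longrightarrow> endo T \<Longrightarrow> endo (\<lambda>x. S (T x))"
  by (simp add: Vector_Spaces.linear_iff)

context
  fixes B assumes B: "independent B" "span B = UNIV"
begin

lemma killing_simps:
  "killing B x (y + z) = killing B x y + killing B x z"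
  "killing B x (sc c y) = c * killing B x y"
  "killing B x (- y) = - killing B x y"
  "killing B x 0 = 0"
proof -
  show add: "killing B x (y + z) = killing B x y + killing B x z" for y z
    by (simp add: killing_def br_simps trace_in_simps[OF B])
  show scale: "killing B x (sc c y) = c * killing B x y" for c
    by (simp add: killing_def br_simps trace_in_simps[OF B])
  show "killing B x 0 = 0"
    using scale[of 0] by simp
  then show "killing B x (- y) = - killing B x y"
    using add[of y "- y"] by (simp add: eq_neg_iff_add_eq_0 add.commute)
qed

text \<open>Write ad [x, y] as a commutator and move ad y to the right end by cyclicity of the
  trace. What remains is ad x composed with the commutator of ad y and \<open>D\<close>, which is -
  ad (D y).\<close>

lemma trace_ad_br_derivation:
  assumes D: "derivation D"
  shows "trace_in B (\<lambda>z. br (br x y) (D z)) = - killing B x (D y)"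
proof -
  have lin: "endo D" and Leibniz: "\<And>y z. D (br y z) = br (D y) z + br y (D z)"
    using D by (simp_all add: derivation_def)
  have "trace_in B (\<lambda>z. br (br x y) (D z))
      = trace_in B (\<lambda>z. br x (br y (D z)) - br y (br x (D z)))"
    by (simp add: br_br)
  also have "\<dots> = trace_in B (\<lambda>z. br x (br y (D z))) - trace_in B (\<lambda>z. br y (br x (D z)))"
    by (rule trace_in_simps[OF B])
  also have "trace_in B (\<lambda>z. br y (br x (D z))) = trace_in B (\<lambda>z. br x (D (br y z)))"
    by (rule trace_in_commute[OF B endo_ad endo_comp[OF endo_ad lin]])
  also have "trace_in B (\<lambda>z. br x (br y (D z))) - trace_in B (\<lambda>z. br x (D (br y z)))
      = trace_in B (\<lambda>z. br x (br y (D z)) - br x (D (br y z)))"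
    by (rule trace_in_simps[OF B, symmetric])
  also have "\<dots> = trace_in B (\<lambda>z. sc (-1) (br x (br (D y) z)))"
    by (simp add: Leibniz br_simps)
  also have "\<dots> = - killing B x (D y)"
    by (simp only: trace_in_simps[OF B] killing_def) simp
  finally show ?thesis .
qed

text \<open>This is the preceding identity for the inner derivation ad z.\<close>

lemma killing_invariant: "killing B (br x y) z = killing B x (br y z)"
  using trace_ad_br_derivation[OF derivation_ad, of x y z] br_antisym[of y z]
  by (simp add: killing_def[of B "br x y"] killing_simps)

end

text \<open>Half of Cartan's criterion. The trace of \<open>ad x\<close> against its conjugate derivation is the sum
  of the squared moduli of the eigenvalues of \<open>ad x\<close>.\<close>
lemma killing_0_imp_ad_nilpotent:
  assumes perfect: "span {br x y | x y. True} = UNIV"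
    and killing: "\<And>B x y. independent B \<Longrightarrow> span B = UNIV \<Longrightarrow> killing B x y = 0"
  shows "y \<in> gen_eigenspace (br x) 0"
proof -
  obtain B m where B: "independent B" "span B = UNIV"
    and m: "\<And>b. b \<in> B \<Longrightarrow> b \<in> gen_eigenspace (br x) (m b)"
      "\<And>b. b \<in> B \<Longrightarrow> representation B (br x b) b = m b"
    using adapted_basis[OF endo_ad[of x]] by blast
  obtain \<delta> where \<delta>: "derivation \<delta>" "\<And>b. b \<in> B \<Longrightarrow> \<delta> b = sc (cnj (m b)) b"
    using conjugate_derivation[OF derivation_ad B m(1)] by blast
  \<comment> \<open>The trace of ad u against the conjugate derivation is, on brackets, minus a
    Killing value and hence 0; perfectness carries this to \<open>x\<close> itself.\<close>
  have "{br u v | u v. True} \<subseteq> {u. trace_in B (\<lambda>z. br u (\<delta> z)) = 0}"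
    by (auto simp: trace_ad_br_derivation[OF B \<delta>(1)] killing[OF B])
  moreover have "subspace {u. trace_in B (\<lambda>z. br u (\<delta> z)) = 0}"
    by (rule subspaceI) (simp_all add: br_simps trace_in_simps[OF B], simp add: trace_in_def representation_zero)
  ultimately have "span {br u v | u v. True} \<subseteq> {u. trace_in B (\<lambda>z. br u (\<delta> z)) = 0}"
    by (rule span_minimal)
  then have "trace_in B (\<lambda>z. br x (\<delta> z)) = 0"
    using perfect by auto
  then have "(\<Sum>b\<in>B. cnj (m b) * m b) = 0"
    by (simp add: trace_in_def \<delta>(2) br_simps representation_simps[OF B] m(2))
  then have "(\<Sum>b\<in>B. complex_of_real ((cmod (m b))\<^sup>2)) = 0"
    by (simp only: complex_norm_square mult.commute)
  then have "complex_of_real (\<Sum>b\<in>B. (cmod (m b))\<^sup>2) = 0"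
    by (simp only: of_real_sum)
  then have "(\<Sum>b\<in>B. (cmod (m b))\<^sup>2) = 0"
    by (simp only: of_real_eq_0_iff)
  then have "m b = 0" if "b \<in> B" for b
    using that finiteI_independent[OF B(1)] by (simp add: sum_nonneg_eq_0_iff)
  with m(1) have "B \<subseteq> gen_eigenspace (br x) 0"
    by force
  then have "span B \<subseteq> gen_eigenspace (br x) 0"
    by (rule span_minimal) (rule subspace_gen_eigenspace[OF endo_ad])
  with B(2) show ?thesis
    by blast
qed

text \<open>Engel's theorem. The property \<open>E M\<close> says that \<open>M\<close> has a null vector in every subquotient;
  a maximal subalgebra with \<open>E\<close> applied to the subquotient \<open>UNIV / M\<close> could be enlarged.\<close>
lemma engel:
  assumes nil: "\<And>x y. y \<in> gen_eigenspace (br x) 0" and "\<exists>x::'a. x \<noteq> 0"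
  shows "\<exists>w. w \<noteq> 0 \<and> (\<forall>x. br x w = 0)"
proof -
  define E where "E M \<longleftrightarrow> (\<forall>U W. subspace U \<and> subspace W \<and> U \<subset> W \<and>
      (\<forall>x\<in>M. \<forall>u\<in>U. br x u \<in> U) \<and> (\<forall>x\<in>M. \<forall>u\<in>W. br x u \<in> W) \<longrightarrow>
      (\<exists>w\<in>W - U. \<forall>x\<in>M. br x w \<in> U))" for M
  define Q where "Q M \<longleftrightarrow> subspace M \<and> (\<forall>x\<in>M. \<forall>y\<in>M. br x y \<in> M) \<and> E M" for M
  have "E {0}"
    unfolding E_def by (auto simp: br_simps subspace_0)
  then have "Q {0}"
    by (simp add: Q_def)
  moreover have "dim M < Suc dimension" for M
    using dim_subset_UNIV[of M] by simp
  ultimately obtain M where M: "Q M" and max: "\<And>N. Q N \<Longrightarrow> dim N \<le> dim M"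
    using ex_has_greatest_nat[of Q "{0}" dim "Suc dimension"] by auto
  have sub: "subspace M" and closed: "\<And>x y. x \<in> M \<Longrightarrow> y \<in> M \<Longrightarrow> br x y \<in> M" and EM: "E M"
    using M by (auto simp: Q_def)
  have "M = UNIV"
  proof (rule ccontr)
    assume "M \<noteq> UNIV"
    \<comment> \<open>Applying \<open>E\<close> to the action of \<open>M\<close> on UNIV / M gives
      \<open>w\<close> outside \<open>M\<close> that normalises \<open>M\<close>, so
      \<open>M\<close> and \<open>w\<close> span a subalgebra.\<close>
    then have "\<exists>w\<in>UNIV - M. \<forall>x\<in>M. br x w \<in> M"
      using sub closed by (intro EM[unfolded E_def, rule_format]) auto
    then obtain w where w: "w \<notin> M" "\<And>x. x \<in> M \<Longrightarrow> br x w \<in> M"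
      by blast
    let ?N = "span (insert w M)"
    have span_M: "span M = M"
      using sub by simp
    have N: "x \<in> ?N \<longleftrightarrow> (\<exists>k m. m \<in> M \<and> x = m + sc k w)" for x
      unfolding span_breakdown_eq span_M by (metis add_diff_cancel_right' diff_add_cancel)
    have wM: "br w x \<in> M" if "x \<in> M" for x
      using w(2)[OF that] br_antisym[of w x] subspace_neg[OF sub] by simp
    have "E ?N"
      unfolding E_def
    proof (intro allI impI, elim conjE)
      fix U W assume U: "subspace U" and W: "subspace W" and "U \<subset> W"
        and UN: "\<forall>x\<in>?N. \<forall>u\<in>U. br x u \<in> U" and WN: "\<forall>x\<in>?N. \<forall>u\<in>W. br x u \<in> W"
      have MN: "x \<in> ?N" if "x \<in> M" for x
        using that by (simp add: span_base)
      have wN: "w \<in> ?N"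
        by (simp add: span_base)
      \<comment> \<open>These vectors represent the null space of \<open>M\<close> on W / U. It is
        stable under ad w because \<open>w\<close> normalises \<open>M\<close>.\<close>
      let ?W = "{v\<in>W. \<forall>x\<in>M. br x v \<in> U}"
      obtain v where v: "v \<in> ?W" "v \<notin> U"
        using EM[unfolded E_def, rule_format, of U W] U W \<open>U \<subset> W\<close> UN WN MN by auto
      have "subspace ?W"
        using U W by (intro subspaceI) (auto simp: br_simps subspace_0 subspace_add subspace_scale)
      moreover have "br w v \<in> ?W" if v: "v \<in> ?W" for v
      proof -
        have "br x (br w v) \<in> U" if "x \<in> M" for x
          unfolding ad_br[of x w] using v w(2)[OF that] UN wN that
          by (auto intro!: subspace_add[OF U])
        with v WN wN show ?thesis
          by blast
      qed
      \<comment> \<open>By nilpotency ad w has a null vector modulo \<open>U\<close> within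
        \<open>?W\<close>; it is then null for \<open>M\<close> and \<open>w\<close>
        together.\<close>
      ultimately obtain u where u: "u \<in> ?W" "u \<notin> U" "br w u \<in> U"
        using eigenvector_modulo[OF endo_ad[of w] nil v(2) subspace_0[OF U] v(1)] by auto
      have "br x u \<in> U" if "x \<in> ?N" for x
        using that u U unfolding N
        by (auto simp: br_simps intro!: subspace_add subspace_scale)
      with u show "\<exists>w\<in>W - U. \<forall>x\<in>?N. br x w \<in> U"
        by blast
    qed
    moreover have "br x y \<in> ?N" if "x \<in> ?N" "y \<in> ?N" for x y
    proof -
      obtain k l m n where mn: "m \<in> M" "n \<in> M" "x = m + sc k w" "y = n + sc l w"
        using \<open>x \<in> ?N\<close> \<open>y \<in> ?N\<close> unfolding N by blast
      have "br x y \<in> M"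
        unfolding mn using mn(1,2) closed w(2) wM
        by (simp add: br_simps subspace_add[OF sub] subspace_scale[OF sub])
      then show ?thesis
        by (simp add: span_base)
    qed
    ultimately have "Q ?N"
      by (simp add: Q_def)
    then have "dim ?N \<le> dim M"
      by (rule max)
    moreover have "w \<notin> span M"
      using w(1) unfolding span_M .
    ultimately show False
      by (simp add: dim_insert)
  qed
  \<comment> \<open>Now \<open>E\<close> is used for the adjoint action on the whole space modulo
    0.\<close>
  then have "\<exists>w\<in>UNIV - {0}. \<forall>x\<in>UNIV. br x w \<in> {0}"
    using EM assms(2) unfolding E_def
    by (elim allE[of _ "{0}"] allE[of _ UNIV]) (auto simp: br_simps)
  then show ?thesis
    by auto
qed

end

section \<open>Simple Lie algebras: perfect, centreless, with nondegenerate Killing form\<close>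

locale simple_fin_dim_lie_algebra = fin_dim_lie_algebra +
  assumes nonabelian: "\<exists>x y. br x y \<noteq> 0"
    and simple: "lie_ideal sc br I \<Longrightarrow> I = {0} \<or> I = UNIV"
begin

lemma lie_idealI:
  assumes "subspace I" "\<And>x y. y \<in> I \<Longrightarrow> br x y \<in> I"
  shows "lie_ideal sc br I"
  using assms by (simp add: lie_ideal_def)

lemma perfect: "span {br x y | x y. True} = UNIV"
proof -
  let ?S = "span {br x y | x y. True}"
  have "lie_ideal sc br ?S"
  proof (rule lie_idealI)
    show "br x y \<in> ?S" for x y
      by (rule span_base) blast
  qed simp
  moreover obtain x y where "br x y \<noteq> 0"
    using nonabelian by blast
  then have "?S \<noteq> {0}"
    using span_base[of "br x y" "{br x y | x y. True}"] by blast
  ultimately show ?thesis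
    using simple by blast
qed

text \<open>Perfectness as an induction rule; the zero vector is covered as
  \<open>br 0 0\<close>.\<close>

lemma perfect_induct [case_names add scale br]:
  assumes "\<And>x y. P x \<Longrightarrow> P y \<Longrightarrow> P (x + y)" "\<And>c x. P x \<Longrightarrow> P (sc c x)" "\<And>x y. P (br x y)"
  shows "P z"
proof -
  have "subspace {z. P z}"
    using assms assms(3)[of 0 0] by (auto intro!: subspaceI)
  then have "span {br x y | x y. True} \<subseteq> {z. P z}"
    using assms(3) by (intro span_minimal) auto
  then show ?thesis
    unfolding perfect by blast
qed

lemma centreless:
  assumes "\<And>x. br x z = 0"
  shows "z = 0"
proof -
  have "lie_ideal sc br {z. \<forall>x. br x z = 0}"
    by (rule lie_idealI) (auto intro!: subspaceI simp: br_simps)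
  then have "{z. \<forall>x. br x z = 0} = {0} \<or> {z. \<forall>x. br x z = 0} = UNIV"
    by (rule simple)
  with assms nonabelian show ?thesis
    by blast
qed

text \<open>By perfectness the two elements have the same adjoint map, so their difference is
  central. This serves as the uniqueness principle for maps defined through brackets.\<close>

lemma eqI_br:
  assumes "\<And>u v. br a (br u v) = br b (br u v)"
  shows "a = b"
proof -
  have "br a z = br b z" for z
    by (induction z rule: perfect_induct) (simp_all add: br_simps assms)
  then have "br z (a - b) = 0" for z
    by (simp add: br_antisym[of z] br_simps)
  then show ?thesis
    using centreless[of "a - b"] by simp
qed

text \<open>Otherwise every ad x is nilpotent, and Engel's theorem produces a nonzero central
  element.\<close>

lemma killing_not_0: "\<exists>B x y. independent B \<and> span B = UNIV \<and> killing B x y \<noteq> 0"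
proof (rule ccontr)
  assume "\<not> ?thesis"
  then have "y \<in> gen_eigenspace (br x) 0" for x y
    by (intro killing_0_imp_ad_nilpotent[OF perfect]) auto
  moreover have "\<exists>x::'a. x \<noteq> 0"
    using nonabelian by blast
  ultimately obtain w where "w \<noteq> 0" "\<And>x. br x w = 0"
    using engel by blast
  with centreless show False
    by blast
qed

text \<open>By invariance the radical of the form is an ideal, and it is proper because the form is
  not zero.\<close>

lemma killing_nondegenerate:
  "\<exists>B. independent B \<and> span B = UNIV \<and> (\<forall>y. (\<forall>x. killing B x y = 0) \<longrightarrow> y = 0)"
proof -
  obtain B u v where B: "independent B" "span B = UNIV" and uv: "killing B u v \<noteq> 0"
    using killing_not_0 by blast
  have "lie_ideal sc br {y. \<forall>x. killing B x y = 0}"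
    by (rule lie_idealI)
      (auto intro!: subspaceI simp: killing_simps[OF B] killing_invariant[OF B, symmetric])
  then have "{y. \<forall>x. killing B x y = 0} = {0} \<or> {y. \<forall>x. killing B x y = 0} = UNIV"
    by (rule simple)
  with uv have "{y. \<forall>x. killing B x y = 0} = {0}"
    by blast
  with B show ?thesis
    by blast
qed

section \<open>Biderivations of a simple Lie algebra\<close>

context
  fixes f assumes f: "biderivation sc br f"
begin

lemma biderivation_br:
  "f (br x y) z = br x (f y z) + br (f x z) y"
  "f x (br y z) = br (f x y) z + br y (f x z)"
  using f by (simp_all add: biderivation_def)

lemma biderivation_bilinear: "bilinear_map sc f"
  using f by (simp add: biderivation_def)

lemmas biderivation_simps = bilinear_simps[OF biderivation_bilinear]

lemma derivation_biderivation: "derivation (f x)"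
  using bilinear_endo(1)[OF biderivation_bilinear] biderivation_br(2) by (simp add: derivation_def)

text \<open>The form \<open>killing B x (f y z)\<close> is symmetric in \<open>y, z\<close> and, being the trace of
  \<open>ad [x, y]\<close> against \<open>f z\<close> up to sign, antisymmetric in \<open>x, y\<close>; such a form vanishes.\<close>
lemma symmetric_biderivation_0:
  assumes sym: "\<And>x y. f x y = f y x"
  shows "f x y = 0"
proof -
  obtain B where B: "independent B" "span B = UNIV"
    and nd: "\<And>y. (\<And>x. killing B x y = 0) \<Longrightarrow> y = 0"
    using killing_nondegenerate by blast
  define k where "k x y z = killing B x (f y z)" for x y z
  have k: "k x z y = - trace_in B (\<lambda>w. br (br x y) (f z w))" for x y z
    using trace_ad_br_derivation[OF B derivation_biderivation, of x y z] by (simp add: k_def)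
  have swap: "trace_in B (\<lambda>w. br (br x y) (f z w)) = - trace_in B (\<lambda>w. br (br y x) (f z w))" for x y z
  proof -
    have "br (br x y) (f z w) = sc (-1) (br (br y x) (f z w))" for w
      using br_antisym[of x y] by (simp add: br_minus)
    then show ?thesis
      by (simp add: trace_in_simps(3)[OF B, of "-1", simplified])
  qed
  have anti: "k x z y = - k y z x" for x y z
    unfolding k by (subst swap) simp
  have sym': "k x y z = k x z y" for x y z
    using sym by (simp add: k_def)
  have "k x y z = 0" for x y z
  proof -
    \<comment> \<open>Alternating the two transpositions six times returns to the start after three
      sign changes.\<close>
    have "k x y z = - k z y x" by (rule anti)
    also have "k z y x = k z x y" by (rule sym')
    also have "k z x y = - k y x z" by (rule anti)
    also have "k y x z = k y z x" by (rule sym')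
    also have "k y z x = - k x z y" by (rule anti)
    also have "k x z y = k x y z" by (rule sym')
    finally show ?thesis by simp
  qed
  then show ?thesis
    using nd by (simp add: k_def)
qed

text \<open>The two expansions of f [x, u] [y, v] differ in which argument is opened first.\<close>

lemma biderivation_exchange:
  "br (br x y) (f u v) - br (f x y) (br u v) = br (br x v) (f u y) - br (f x v) (br u y)"
proof -
  have "br x (br (f u y) v) + br x (br y (f u v)) + br (br (f x y) v) u + br (br y (f x v)) u
      = br x (f u (br y v)) + br (f x (br y v)) u"
    by (simp add: biderivation_br(2)[of _ y v] br_simps)
  also have "\<dots> = f (br x u) (br y v)"
    by (rule biderivation_br(1)[symmetric])
  also have "\<dots> = br (f (br x u) y) v + br y (f (br x u) v)"
    by (rule biderivation_br(2))
  also have "\<dots> = br (br x (f u y)) v + br (br (f x y) u) v + br y (br x (f u v)) + br y (br (f x v) u)"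
    by (simp add: biderivation_br(1)[of x u] br_simps)
  finally have eq: "br x (br (f u y) v) + br x (br y (f u v)) + br (br (f x y) v) u + br (br y (f x v)) u
      = br (br x (f u y)) v + br (br (f x y) u) v + br y (br x (f u v)) + br y (br (f x v) u)" .
  \<comment> \<open>Jacobi rewrites each term on the left as a term on the right plus one term of
    the claim; the common terms cancel.\<close>
  have 1: "br x (br (f u y) v) = br (br x (f u y)) v - br (br x v) (f u y)"
    using ad_br[of x "f u y" v] br_antisym[of "f u y" "br x v"] by simp
  have 2: "br x (br y (f u v)) = br (br x y) (f u v) + br y (br x (f u v))"
    by (rule ad_br)
  have 3: "br (br (f x y) v) u = br (br (f x y) u) v - br (f x y) (br u v)"
    using ad_br[of "f x y" u v] br_antisym[of u "br (f x y) v"] by (simp add: algebra_simps)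
  have 4: "br (br y (f x v)) u = br y (br (f x v) u) + br (f x v) (br u y)"
    using br_br[of y "f x v" u] br_antisym[of y u] by (simp add: br_minus)
  show ?thesis
    using eq unfolding 1 2 3 4 by (simp add: algebra_simps)
qed

text \<open>The defect \<open>\<Phi>\<close> is invariant under exchanging its second and fourth arguments and changes
  sign under exchanging the first two; these transpositions are conjugate, so \<open>\<Phi>\<close> vanishes.\<close>
lemma skew_biderivation_adjoint:
  assumes skew: "\<And>x y. f x y = - f y x"
  shows "br (f x y) (br u v) = br (br x y) (f u v)"
proof -
  define \<Phi> where "\<Phi> x y u v = br (br x y) (f u v) - br (f x y) (br u v)" for x y u v
  have exch: "\<Phi> x y u v = \<Phi> x v u y" for x y u v
    unfolding \<Phi>_def by (rule biderivation_exchange)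
  have anti: "\<Phi> x y u v = - \<Phi> y x u v" for x y u v
    using br_antisym[of x y] skew[of x y] by (simp add: \<Phi>_def br_minus)
  have "\<Phi> x y u v = \<Phi> x v u y" by (rule exch)
  also have "\<Phi> x v u y = - \<Phi> v x u y" by (rule anti)
  also have "\<Phi> v x u y = \<Phi> v y u x" by (rule exch)
  also have "\<Phi> v y u x = - \<Phi> y v u x" by (rule anti)
  also have "\<Phi> y v u x = \<Phi> y x u v" by (rule exch)
  also have "\<Phi> y x u v = - \<Phi> x y u v" by (rule anti)
  \<comment> \<open>The vectors form only an abelian group, so halving goes through the scalar
    2.\<close>
  finally have "sc 2 (\<Phi> x y u v) = 0"
    by (simp add: scale_left_distrib[of 1 1, simplified] eq_neg_iff_add_eq_0)
  then have "\<Phi> x y u v = 0"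
    by simp
  then show ?thesis
    by (simp add: \<Phi>_def)
qed

text \<open>The condition [\<gamma> a, [u, v]] = [a, f u v] determines \<gamma> a uniquely. The
  resulting \<gamma> can be moved between the two slots of a bracket; that it commutes with every ad
  x is the harder part.\<close>

lemma skew_biderivation_centroid:
  assumes skew: "\<And>x y. f x y = - f y x"
  shows "\<exists>\<gamma>. endo \<gamma> \<and> (\<forall>x y. f x y = \<gamma> (br x y)) \<and> (\<forall>x y. \<gamma> (br x y) = br x (\<gamma> y))"
proof -
  \<comment> \<open>For a bracket \<open>br x y\<close> the adjoint identity supplies the witness
    \<open>f x y\<close>; perfectness gives the rest.\<close>
  have "\<exists>c. \<forall>u v. br c (br u v) = br a (f u v)" for a
  proof (induction a rule: perfect_induct)
    case (add x y)
    then obtain c d where "\<forall>u v. br c (br u v) = br x (f u v)" "\<forall>u v. br d (br u v) = br y (f u v)"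
      by blast
    then show ?case
      by (intro exI[of _ "c + d"]) (simp add: br_simps)
  next
    case (scale k x)
    then obtain c where "\<forall>u v. br c (br u v) = br x (f u v)"
      by blast
    then show ?case
      by (intro exI[of _ "sc k c"]) (simp add: br_simps)
  next
    case (br x y)
    then show ?case
      using skew_biderivation_adjoint[OF skew] by blast
  qed
  then obtain \<gamma> where \<gamma>: "\<And>a u v. br (\<gamma> a) (br u v) = br a (f u v)"
    by metis
  have lin: "endo \<gamma>"
    by (rule endoI; rule eqI_br) (simp_all only: \<gamma> br_simps)
  have \<gamma>f: "\<gamma> (br x y) = f x y" for x y
    by (rule eqI_br) (simp only: \<gamma> skew_biderivation_adjoint[OF skew])
  have adj: "br (\<gamma> a) b = br a (\<gamma> b)" for a b
    by (induction b rule: perfect_induct)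
      (simp_all add: endo_add[OF lin] endo_scale[OF lin] br_simps \<gamma>f \<gamma>)
  have "\<gamma> (br x y) = br x (\<gamma> y)" for x y
  proof -
    \<comment> \<open>This is the commutator of \<gamma> and ad x, written as a difference of two
      derivations. It is thus a derivation that can also be moved between the slots of a
      bracket.\<close>
    define \<delta> where "\<delta> a = f x a - br (\<gamma> x) a" for a
    have \<delta>_eq: "\<delta> a = \<gamma> (br x a) - br x (\<gamma> a)" for a
      by (simp add: \<delta>_def \<gamma>f adj)
    have \<delta>_add: "\<delta> (a + b) = \<delta> a + \<delta> b" and \<delta>_scale: "\<delta> (sc c a) = sc c (\<delta> a)" for a b c
      by (simp_all add: \<delta>_def biderivation_simps br_simps scale_right_diff_distrib)
    have \<delta>_adj: "br (\<delta> a) b = br a (\<delta> b)" for a b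
    proof -
      have "br (\<delta> a) b = br (br x a) (\<gamma> b) - br (br x (\<gamma> a)) b"
        by (simp add: \<delta>_eq br_simps adj)
      also have "br (br x a) (\<gamma> b) = br x (br a (\<gamma> b)) - br a (br x (\<gamma> b))"
        by (rule br_br)
      also have "br (br x (\<gamma> a)) b = br x (br (\<gamma> a) b) - br (\<gamma> a) (br x b)"
        by (rule br_br)
      finally show ?thesis
        by (simp add: \<delta>_eq br_simps adj)
    qed
    have \<delta>_br: "\<delta> (br a b) = br (\<delta> a) b + br (\<delta> a) b" for a b
    proof -
      have "\<delta> (br a b) = br (\<delta> a) b + br a (\<delta> b)"
        by (simp add: \<delta>_def biderivation_br(2) ad_br[of "\<gamma> x"] br_simps)
      then show ?thesis
        by (simp only: \<delta>_adj)
    qed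
    have \<delta>_br': "\<delta> (br a b) = br a (\<delta> b) + br a (\<delta> b)" for a b
      by (simp only: \<delta>_br \<delta>_adj)
    \<comment> \<open>Leibniz and adjointness give \<delta> [a, b] = 2 [\<delta> a, b]. Opening a
      triple bracket with this in two ways shows that twice its value equals its value.\<close>
    have "\<delta> (br a (br b c)) = 0" for a b c
    proof -
      have "\<delta> (br a (br b c)) = br (\<delta> a) (br b c) + br (\<delta> a) (br b c)"
        by (rule \<delta>_br)
      also have "\<dots> = br (\<delta> (br a b)) c + br b (\<delta> (br a c))"
        by (simp add: ad_br[of "\<delta> a"] \<delta>_br[of a] br_simps)
      finally have "\<delta> (br a (br b c)) + \<delta> (br a (br b c)) = \<delta> (br (br a b) c) + \<delta> (br b (br a c))"
        by (simp add: \<delta>_br[of "br a b"] \<delta>_br'[of b])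
      also have "\<dots> = \<delta> (br a (br b c))"
        by (simp only: \<delta>_add[symmetric] ad_br[symmetric])
      finally show ?thesis
        by simp
    qed
    then have "\<delta> (br a z) = 0" for a z
      by (induction z rule: perfect_induct) (simp_all add: br_simps \<delta>_add \<delta>_scale)
    then have "\<delta> y = 0"
      by (induction y rule: perfect_induct) (simp_all add: \<delta>_add \<delta>_scale)
    then show ?thesis
      by (simp add: \<delta>_eq)
  qed
  with lin \<gamma>f show ?thesis
    by metis
qed

text \<open>Schur's lemma: an eigenspace of \<gamma> is a nonzero ideal, hence everything.\<close>

lemma skew_biderivation_scalar:
  assumes skew: "\<And>x y. f x y = - f y x"
  shows "\<exists>c. \<forall>x y. f x y = sc c (br x y)"
proof -
  obtain \<gamma> where lin: "endo \<gamma>" and f_eq: "\<And>x y. f x y = \<gamma> (br x y)"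
    and comm: "\<And>x y. \<gamma> (br x y) = br x (\<gamma> y)"
    using skew_biderivation_centroid[OF skew] by blast
  obtain c v where v: "v \<noteq> 0" "\<gamma> v = sc c v"
    using exists_eigenvector[OF lin] nonabelian by blast
  have "lie_ideal sc br {a. \<gamma> a = sc c a}"
    by (rule lie_idealI)
      (auto intro!: subspaceI simp: comm br_simps endo_add[OF lin] endo_scale[OF lin] endo_0[OF lin]
        scale_right_distrib mult.commute)
  then have "{a. \<gamma> a = sc c a} = {0} \<or> {a. \<gamma> a = sc c a} = UNIV"
    by (rule simple)
  with v have "\<gamma> a = sc c a" for a
    by blast
  then show ?thesis
    using f_eq by auto
qed

text \<open>Interchanging the arguments of \<open>f\<close> turns each biderivation identity into
  the other, so the flipped map is again a biderivation.\<close>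

lemma biderivation_symmetrization: "biderivation sc br (\<lambda>x y. f x y + f y x)"
  unfolding biderivation_def bilinear_map_def
  by (intro conjI allI endoI)
    (simp_all add: biderivation_simps br_simps biderivation_br scale_right_distrib algebra_simps)

end

lemma biderivation_scalar_br: "biderivation sc br (\<lambda>x y. sc c (br x y))"
  unfolding biderivation_def bilinear_map_def
proof (intro conjI allI endoI)
  show "sc c (br (br x y) z) = br x (sc c (br y z)) + br (sc c (br x z)) y" for x y z
    using br_antisym[of "br x z" y]
    by (simp add: br_br[of x y] br_simps scale_right_diff_distrib)
  show "sc c (br x (br y z)) = br (sc c (br x y)) z + br y (sc c (br x z))" for x y z
    by (simp add: ad_br[of x y z] br_simps scale_right_distrib)
qed (simp_all add: br_simps scale_right_distrib mult.commute)

theorem biderivation_iff_scalar: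
  "biderivation sc br f \<longleftrightarrow> (\<exists>c. \<forall>x y. f x y = sc c (br x y))"
proof
  assume f: "biderivation sc br f"
  \<comment> \<open>Vanishing of the symmetrization says exactly that \<open>f\<close> is
    skew-symmetric.\<close>
  have "f x y + f y x = 0" for x y
    by (rule symmetric_biderivation_0[OF biderivation_symmetrization[OF f]]) (rule add.commute)
  then show "\<exists>c. \<forall>x y. f x y = sc c (br x y)"
    by (intro skew_biderivation_scalar[OF f]) (simp add: eq_neg_iff_add_eq_0)
next
  assume "\<exists>c. \<forall>x y. f x y = sc c (br x y)"
  then obtain c where "f = (\<lambda>x y. sc c (br x y))"
    by blast
  then show "biderivation sc br f"
    by (simp add: biderivation_scalar_br)
qed

end

section \<open>Passage from the stated hypotheses to the locale\<close>

theorem theorem2p4: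
  fixes sc :: "complex \<Rightarrow> 'a::ab_group_add \<Rightarrow> 'a"
    and br :: "'a \<Rightarrow> 'a \<Rightarrow> 'a"
    and f :: "'a \<Rightarrow> 'a \<Rightarrow> 'a"
  assumes "finite_dim_lie_algebra sc br"
    and "simple_lie_algebra sc br"
  shows "biderivation sc br f \<longleftrightarrow> (\<exists>c::complex. \<forall>x y. f x y = sc c (br x y))"
proof -
  have lie: "lie_algebra sc br" and "\<exists>B. finite B \<and> module.span sc B = UNIV"
    using assms(1) by (auto simp: finite_dim_lie_algebra_def)
  then obtain S where S: "finite S" "module.span sc S = UNIV"
    by blast
  interpret vector_space sc
    using lie by (simp add: lie_algebra_def)
  \<comment> \<open>The locale is parametrised by a finite basis, so one is extracted from the
    finite spanning set.\<close>
  obtain B where B: "B \<subseteq> S" "independent B" "S \<subseteq> span B"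
    using maximal_independent_subset[of S] by blast
  have "span B = UNIV"
    using S(2) span_minimal[OF B(3)] by auto
  with B S(1) interpret simple_fin_dim_lie_algebra sc B br
    using lie assms(2)
    by unfold_locales
      (auto intro: finite_subset simp: lie_algebra_def simple_lie_algebra_def)
  show ?thesis
    by (rule biderivation_iff_scalar)
qed

end
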